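(* Let $n\ge2$. The algebraic left ideal $\mathfrak{L}_nL_2=\{AL_2: A\in\mathfrak{L}_n\}$ is not norm closed.
   Context: Let $\mathcal{F}_n$ be the unital free semigroup on $n$ generators $z_1,\dots,z_n$ (its unit is the empty word $1$), and let $\mathcal{H}_n=\ell_2(\mathcal{F}_n)$, with orthonormal basis $\{\xi_w: w\in\mathcal{F}_n\}$. Let $L_i$ be the isometry on $\mathcal{H}_n$ with $L_i\xi_v=\xi_{z_iv}$. The non-commutative analytic Toeplitz algebra $\mathfrak{L}_n$ is the unital algebra, closed in the weak operator topology, generated by $L_1,\dots,L_n$ in $\mathcal{B}(\mathcal{H}_n)$. *)

theory Defs
  imports "HOL-Analysis.Analysis"
begin

section \<open>The complex Hilbert space of square-summable families\<close>

typedef 'a ell2 = "{f :: 'a \<Rightarrow> complex. (\<lambda>x. (cmod (f x))\<^sup>2) summable_on UNIV}"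
  morphisms coord Abs_ell2
  by (rule exI[of _ "\<lambda>_. 0"]) simp

setup_lifting type_definition_ell2

lemma sq_summable_add:
  fixes f g :: "'a \<Rightarrow> complex"
  assumes f: "(\<lambda>x. (cmod (f x))\<^sup>2) summable_on A" and g: "(\<lambda>x. (cmod (g x))\<^sup>2) summable_on A"
  shows "(\<lambda>x. (cmod (f x + g x))\<^sup>2) summable_on A"
proof (rule summable_on_comparison_test)
  show "(\<lambda>x. 2 * (cmod (f x))\<^sup>2 + 2 * (cmod (g x))\<^sup>2) summable_on A"
    by (intro summable_on_add summable_on_cmult_right f g)
  fix x
  have "(cmod (f x + g x))\<^sup>2 \<le> (cmod (f x) + cmod (g x))\<^sup>2"
    by (intro power_mono norm_triangle_ineq) auto
  also have "\<dots> \<le> 2 * (cmod (f x))\<^sup>2 + 2 * (cmod (g x))\<^sup>2"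
    using sum_squares_bound[of "cmod (f x)" "cmod (g x)"]
    by (simp add: power2_sum)
  finally show "(cmod (f x + g x))\<^sup>2 \<le> 2 * (cmod (f x))\<^sup>2 + 2 * (cmod (g x))\<^sup>2" .
qed auto

lemma sq_summable_scale:
  fixes f :: "'a \<Rightarrow> complex"
  assumes "(\<lambda>x. (cmod (f x))\<^sup>2) summable_on A"
  shows "(\<lambda>x. (cmod (c * f x))\<^sup>2) summable_on A"
  using summable_on_cmult_right[OF assms, of "(cmod c)\<^sup>2"]
  by (simp add: norm_mult power_mult_distrib)

lemma sq_summable_mult_cnj:
  fixes f g :: "'a \<Rightarrow> complex"
  assumes f: "(\<lambda>x. (cmod (f x))\<^sup>2) summable_on A" and g: "(\<lambda>x. (cmod (g x))\<^sup>2) summable_on A"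
  shows "(\<lambda>x. f x * cnj (g x)) summable_on A"
proof (rule abs_summable_summable, rule summable_on_comparison_test)
  show "(\<lambda>x. (cmod (f x))\<^sup>2 + (cmod (g x))\<^sup>2) summable_on A"
    by (intro summable_on_add f g)
  fix x
  have "2 * (cmod (f x) * cmod (g x)) \<le> (cmod (f x))\<^sup>2 + (cmod (g x))\<^sup>2"
    using sum_squares_bound[of "cmod (f x)" "cmod (g x)"] by (simp add: mult.assoc)
  moreover have "0 \<le> cmod (f x) * cmod (g x)" by simp
  ultimately show "norm (f x * cnj (g x)) \<le> (cmod (f x))\<^sup>2 + (cmod (g x))\<^sup>2"
    unfolding norm_mult complex_mod_cnj by linarith
qed auto

lift_definition cinner :: "'a ell2 \<Rightarrow> 'a ell2 \<Rightarrow> complex"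
  is "\<lambda>f g. \<Sum>\<^sub>\<infinity>x. f x * cnj (g x)" .

lift_definition scaleC :: "complex \<Rightarrow> 'a ell2 \<Rightarrow> 'a ell2"
  is "\<lambda>c f x. c * f x"
  by (simp add: sq_summable_scale)

instantiation ell2 :: (type) real_inner
begin

lift_definition zero_ell2 :: "'a ell2" is "\<lambda>_. 0" by simp
lift_definition plus_ell2 :: "'a ell2 \<Rightarrow> 'a ell2 \<Rightarrow> 'a ell2" is "\<lambda>f g x. f x + g x"
  by (simp add: sq_summable_add)
lift_definition uminus_ell2 :: "'a ell2 \<Rightarrow> 'a ell2" is "\<lambda>f x. - f x" by simp
lift_definition minus_ell2 :: "'a ell2 \<Rightarrow> 'a ell2 \<Rightarrow> 'a ell2" is "\<lambda>f g x. f x - g x"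
  using sq_summable_add[of _ UNIV "\<lambda>x. - _ x"] by fastforce
lift_definition scaleR_ell2 :: "real \<Rightarrow> 'a ell2 \<Rightarrow> 'a ell2" is "\<lambda>r f x. complex_of_real r * f x"
  by (rule sq_summable_scale)
lift_definition norm_ell2 :: "'a ell2 \<Rightarrow> real" is "\<lambda>f. sqrt (\<Sum>\<^sub>\<infinity>x. (cmod (f x))\<^sup>2)" .

definition inner_ell2 :: "'a ell2 \<Rightarrow> 'a ell2 \<Rightarrow> real"
  where "inner_ell2 f g = Re (cinner f g)"
definition dist_ell2 :: "'a ell2 \<Rightarrow> 'a ell2 \<Rightarrow> real"
  where "dist_ell2 f g = norm (f - g)"
definition sgn_ell2 :: "'a ell2 \<Rightarrow> 'a ell2"
  where "sgn_ell2 f = inverse (norm f) *\<^sub>R f"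
definition uniformity_ell2 :: "('a ell2 \<times> 'a ell2) filter"
  where "uniformity_ell2 = (INF e\<in>{0<..}. principal {(x, y). dist x y < e})"
definition open_ell2 :: "'a ell2 set \<Rightarrow> bool"
  where "open_ell2 U \<longleftrightarrow> (\<forall>x\<in>U. \<forall>\<^sub>F (x', y) in uniformity. x' = x \<longrightarrow> y \<in> U)"

instance
proof
  fix x y z :: "'a ell2" and r s :: real
  have inner_summable: "(\<lambda>i. coord u i * cnj (coord v i)) summable_on UNIV" for u v :: "'a ell2"
    by (rule sq_summable_mult_cnj) (use coord in auto)
  have cinner_self: "cinner u u = complex_of_real (\<Sum>\<^sub>\<infinity>i. (cmod (coord u i))\<^sup>2)" for u :: "'a ell2"
  proof -
    have "(\<lambda>i. (cmod (coord u i))\<^sup>2) summable_on UNIV" using coord[of u] by simp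
    then have "((\<lambda>i. complex_of_real ((cmod (coord u i))\<^sup>2)) has_sum
        complex_of_real (\<Sum>\<^sub>\<infinity>i. (cmod (coord u i))\<^sup>2)) UNIV"
      by (intro has_sum_of_real has_sum_infsum)
    then show ?thesis
      unfolding cinner.rep_eq complex_norm_square by (rule infsumI)
  qed
  show "x + y + z = x + (y + z)" by transfer (simp add: add.assoc)
  show "x + y = y + x" by transfer (simp add: add.commute)
  show "0 + x = x" by transfer simp
  show "- x + x = 0" by transfer simp
  show "x - y = x + - y" by transfer simp
  show "r *\<^sub>R (x + y) = r *\<^sub>R x + r *\<^sub>R y" by transfer (simp add: algebra_simps)
  show "(r + s) *\<^sub>R x = r *\<^sub>R x + s *\<^sub>R x" by transfer (simp add: algebra_simps)
  show "r *\<^sub>R s *\<^sub>R x = (r * s) *\<^sub>R x" by transfer (simp add: algebra_simps)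
  show "1 *\<^sub>R x = x" by transfer simp
  show "sgn x = inverse (norm x) *\<^sub>R x" by (rule sgn_ell2_def)
  show "dist x y = norm (x - y)" by (rule dist_ell2_def)
  show "uniformity = (INF e\<in>{0<..}. principal {(x :: 'a ell2, y). dist x y < e})"
    by (rule uniformity_ell2_def)
  show "open U \<longleftrightarrow> (\<forall>x\<in>U. \<forall>\<^sub>F (x', y) in uniformity. x' = x \<longrightarrow> y \<in> U)" for U :: "'a ell2 set"
    by (rule open_ell2_def)
  have "cinner y x = cnj (cinner x y)"
    unfolding cinner.rep_eq infsum_cnj[symmetric] by (simp add: mult.commute)
  then show "inner x y = inner y x" by (simp add: inner_ell2_def)
  have "cinner (x + y) z = cinner x z + cinner y z"
    unfolding cinner.rep_eq plus_ell2.rep_eq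
    by (simp add: distrib_right infsum_add[OF inner_summable inner_summable])
  then show "inner (x + y) z = inner x z + inner y z" by (simp add: inner_ell2_def)
  have "cinner (r *\<^sub>R x) y = complex_of_real r * cinner x y"
    unfolding cinner.rep_eq scaleR_ell2.rep_eq
    by (simp add: mult.assoc infsum_cmult_right')
  then show "inner (r *\<^sub>R x) y = r * inner x y" by (simp add: inner_ell2_def)
  show "0 \<le> inner x x"
    by (simp add: inner_ell2_def cinner_self infsum_nonneg)
  show "norm x = sqrt (inner x x)"
    by (simp add: inner_ell2_def cinner_self norm_ell2.rep_eq)
  show "inner x x = 0 \<longleftrightarrow> x = 0"
  proof
    assume "inner x x = 0"
    then have "(\<Sum>\<^sub>\<infinity>i. (cmod (coord x i))\<^sup>2) = 0"
      by (simp add: inner_ell2_def cinner_self)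
    then have "(cmod (coord x i))\<^sup>2 = 0" for i
      using nonneg_infsum_le_0D[of "\<lambda>i. (cmod (coord x i))\<^sup>2" UNIV i] coord[of x] by simp
    then show "x = 0" by (intro coord_inject[THEN iffD1]) (auto simp: zero_ell2.rep_eq)
  qed (simp add: inner_ell2_def cinner.rep_eq zero_ell2.rep_eq)
qed

end

lift_definition ket :: "'a \<Rightarrow> 'a ell2" is "\<lambda>x y. if y = x then 1 else 0"
proof -
  fix x :: 'a
  have "(\<lambda>y. (cmod (if y = x then 1 else 0))\<^sup>2) summable_on UNIV
      \<longleftrightarrow> (\<lambda>y. (cmod (if y = x then 1 else 0))\<^sup>2) summable_on {x}"
    by (rule summable_on_cong_neutral) auto
  then show "(\<lambda>y. (cmod (if y = x then 1 else 0))\<^sup>2) summable_on UNIV" by simp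
qed

lemma cinner_ket: "cinner f (ket x) = coord f x"
proof -
  have "cinner f (ket x) = (\<Sum>\<^sub>\<infinity>y\<in>{x}. coord f y * cnj (coord (ket x) y))"
    unfolding cinner.rep_eq by (rule infsum_cong_neutral) (auto simp: ket.rep_eq)
  then show ?thesis by (simp add: ket.rep_eq)
qed


section \<open>Bounded operators and the weak operator topology\<close>

text \<open>The type of bounded linear functions only records linearity over the reals.  The algebra of
  bounded operators on the complex Hilbert space consists of those that are complex linear; the
  operator norm and composition are the ones of that type.\<close>

type_synonym 'a op = "'a ell2 \<Rightarrow>\<^sub>L 'a ell2"

definition bounded_ops :: "'a op set"
  where "bounded_ops = {T. \<forall>c f. blinfun_apply T (scaleC c f) = scaleC c (blinfun_apply T f)}"

lemma norm_scaleC: "norm (scaleC c f) = cmod c * norm f"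
  by (simp add: norm_ell2.rep_eq scaleC.rep_eq norm_mult power_mult_distrib
      infsum_cmult_right' real_sqrt_mult)

lift_definition scaleC_op :: "complex \<Rightarrow> 'a op" is scaleC
proof (rule bounded_linear_intro)
  fix c :: complex and f g :: "'a ell2" and r :: real
  show "scaleC c (f + g) = scaleC c f + scaleC c g" by transfer (simp add: algebra_simps)
  show "scaleC c (r *\<^sub>R f) = r *\<^sub>R scaleC c f" by transfer (simp add: algebra_simps)
  show "norm (scaleC c f) \<le> norm f * cmod c" by (simp add: norm_scaleC)
qed

text \<open>The coarsest topology on the bounded operators making all matrix coefficients
  continuous: the topology on the function type is that of pointwise convergence.\<close>

definition weak_operator_topology :: "'a op topology"
  where "weak_operator_topology =
    pullback_topology bounded_ops (\<lambda>T (f, g). cinner (blinfun_apply T f) g)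
      (euclidean :: ('a ell2 \<times> 'a ell2 \<Rightarrow> complex) topology)"

text \<open>Multiples by complex scalars are composites with \<^term>\<open>scaleC_op c\<close>.\<close>

definition unital_subalgebra :: "'a op set \<Rightarrow> bool"
  where "unital_subalgebra S \<longleftrightarrow>
    S \<subseteq> bounded_ops \<and> id_blinfun \<in> S \<and>
    (\<forall>A\<in>S. \<forall>B\<in>S. A + B \<in> S \<and> A o\<^sub>L B \<in> S) \<and>
    (\<forall>c. \<forall>A\<in>S. scaleC_op c o\<^sub>L A \<in> S)"

definition wot_closed_algebra_generated_by :: "'a op set \<Rightarrow> 'a op set"
  where "wot_closed_algebra_generated_by G =
    \<Inter>{S. unital_subalgebra S \<and> closedin weak_operator_topology S \<and> G \<subseteq> S}"


section \<open>The non-commutative analytic Toeplitz algebra\<close>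

text \<open>The free unital semigroup on the letters in \<^typ>\<open>'a\<close> is \<^typ>\<open>'a list\<close> with concatenation;
  its unit is the empty list.\<close>

definition prepend_coords :: "'a \<Rightarrow> ('a list \<Rightarrow> complex) \<Rightarrow> 'a list \<Rightarrow> complex"
  where "prepend_coords a f w =
    (case w of [] \<Rightarrow> 0 | b # v \<Rightarrow> if b = a then f v else 0)"

lemma prepend_coords_sq:
  fixes f :: "'a list \<Rightarrow> complex"
  shows prepend_coords_summable:
      "(\<lambda>w. (cmod (prepend_coords a f w))\<^sup>2) summable_on UNIV
        \<longleftrightarrow> (\<lambda>v. (cmod (f v))\<^sup>2) summable_on UNIV"
    and prepend_coords_infsum:
      "(\<Sum>\<^sub>\<infinity>w. (cmod (prepend_coords a f w))\<^sup>2) = (\<Sum>\<^sub>\<infinity>v. (cmod (f v))\<^sup>2)"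
proof -
  let ?h = "\<lambda>w. (cmod (prepend_coords a f w))\<^sup>2"
  have inj: "inj ((#) a)" by (simp add: inj_on_def)
  have comp: "?h \<circ> (#) a = (\<lambda>v. (cmod (f v))\<^sup>2)"
    by (auto simp: prepend_coords_def)
  have zero: "?h w = 0" if "w \<notin> range ((#) a)" for w
    using that by (cases w) (auto simp: prepend_coords_def)
  have "?h summable_on UNIV \<longleftrightarrow> ?h summable_on range ((#) a)"
    by (rule summable_on_cong_neutral) (use zero in auto)
  then show "?h summable_on UNIV \<longleftrightarrow> (\<lambda>v. (cmod (f v))\<^sup>2) summable_on UNIV"
    using summable_on_reindex[OF inj, of ?h] by (simp only: comp)
  have "infsum ?h UNIV = infsum ?h (range ((#) a))"
    by (rule infsum_cong_neutral) (use zero in auto)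
  then show "infsum ?h UNIV = (\<Sum>\<^sub>\<infinity>v. (cmod (f v))\<^sup>2)"
    using infsum_reindex[OF inj, of ?h] by (simp only: comp)
qed

lift_definition prepend :: "'a \<Rightarrow> 'a list ell2 \<Rightarrow> 'a list ell2" is prepend_coords
  by (simp add: prepend_coords_summable)

lemma norm_prepend: "norm (prepend a f) = norm f"
  by (simp add: norm_ell2.rep_eq prepend.rep_eq prepend_coords_infsum)

lift_definition L :: "'a \<Rightarrow> 'a list op" is prepend
proof (rule bounded_linear_intro)
  fix a :: 'a and f g :: "'a list ell2" and r :: real
  show "prepend a (f + g) = prepend a f + prepend a g"
    by transfer (auto simp: prepend_coords_def split: list.splits)
  show "prepend a (r *\<^sub>R f) = r *\<^sub>R prepend a f"
    by transfer (auto simp: prepend_coords_def split: list.splits)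
  show "norm (prepend a f) \<le> norm f * 1" by (simp add: norm_prepend)
qed

lemma L_ket: "blinfun_apply (L a) (ket v) = ket (a # v)"
  unfolding L.rep_eq
  by transfer (auto simp: prepend_coords_def fun_eq_iff split: list.splits)

lemma L_isometry: "norm (blinfun_apply (L a) f) = norm f"
  by (simp add: L.rep_eq norm_prepend)

lemma L_bounded_ops: "L a \<in> bounded_ops"
  unfolding bounded_ops_def mem_Collect_eq L.rep_eq
  by (transfer, auto simp: prepend_coords_def fun_eq_iff split: list.splits)

definition nc_toeplitz_algebra :: "'a list op set"
  where "nc_toeplitz_algebra = wot_closed_algebra_generated_by (range L)"

end

theory Submission
  imports Defs
begin

text \<open>
  Write \<open>x = z 1\<close> and \<open>y = z 2\<close>.  The isometries \<open>L\<^sub>x\<^sup>k L\<^sub>y\<close> have pairwise orthogonal ranges, because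
  the words \<open>x\<^sup>k y v\<close> are distinct for distinct \<open>(k, v)\<close>.  So the norm of
  \<open>\<Sum>\<^sub>k a\<^sub>k L\<^sub>x\<^sup>k L\<^sub>y\<close> is the \<open>\<ell>\<^sub>2\<close> norm of the coefficients, and the series converges in norm for every
  square-summable \<open>a\<close>; its partial sums lie in the left ideal.  Without the factor \<open>L\<^sub>y\<close> the norm of
  \<open>\<Sum>\<^sub>k a\<^sub>k L\<^sub>x\<^sup>k\<close> is the supremum norm of the power series \<open>\<Sum>\<^sub>k a\<^sub>k t\<^sup>k\<close> on the disc, which is a strictly
  stronger norm.  The sequence \<open>a\<^sub>k = 1 / (k + 1)\<close> is square-summable, while its power series
  \<open>- ln (1 - t) / t\<close> is unbounded on the disc: a left factor \<open>A\<close> with \<open>\<Sum>\<^sub>k a\<^sub>k L\<^sub>x\<^sup>k L\<^sub>y = A L\<^sub>y\<close> would have to be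
  \<open>\<Sum>\<^sub>k a\<^sub>k L\<^sub>x\<^sup>k\<close>, which is not a bounded operator.

  To make the last step rigorous one has to recover \<open>A\<close> from \<open>A L\<^sub>y\<close>.  Every \<open>A\<close> in the algebra
  commutes with the operators that append a word on the right
  (\<open>nc_toeplitz_commutes_right_append\<close>), since the \<open>L\<^sub>i\<close> do and a commutant of this kind is closed in
  the weak operator topology.  Therefore \<open>A\<close> is determined by its value at the empty word, and that
  value can be read off from \<open>A \<xi>\<^sub>y = A L\<^sub>y \<xi>\<^sub>1\<close>.  It follows that the matrix of \<open>A\<close> with respect to the
  vectors \<open>\<xi>\<close> at \<open>1, x, x\<^sup>2, \<dots>\<close> is the lower triangular Toeplitz matrix with entries \<open>a\<^sub>i\<^sub>-\<^sub>j\<close>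
  (\<open>coord_left_factor\<close>).  Applied to the sum of the first \<open>2 N\<close> of these vectors, that
  matrix has \<open>N\<close> coordinates at least as large as the harmonic number \<open>harm N\<close>; hence
  \<open>(harm N)\<^sup>2 \<le> 2 \<parallel>A\<parallel>\<^sup>2\<close> for all \<open>N\<close>, which is absurd.
\<close>

section \<open>Coordinates in the sequence space\<close>

lemma coord_summable: "(\<lambda>x. (cmod (coord f x))\<^sup>2) summable_on UNIV"
  using coord[of f] by simp

lemma ell2_eqI: "(\<And>x. coord f x = coord g x) \<Longrightarrow> f = g"
  by (metis coord_inject ext)

lemma norm_ell2_sq: "(norm f)\<^sup>2 = (\<Sum>\<^sub>\<infinity>x. (cmod (coord f x))\<^sup>2)"
  by (simp add: norm_ell2.rep_eq infsum_nonneg)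

lemma coord_sum: "coord (\<Sum>i\<in>I. f i) x = (\<Sum>i\<in>I. coord (f i) x)"
  by (induction I rule: infinite_finite_induct) (auto simp: zero_ell2.rep_eq plus_ell2.rep_eq)

lemma coord_scaleC_ket: "coord (scaleC c (ket i)) x = (if x = i then c else 0)"
  by (simp add: scaleC.rep_eq ket.rep_eq)

lemma sum_coord_sq_le_norm_sq:
  assumes "finite S"
  shows "(\<Sum>x\<in>S. (cmod (coord f x))\<^sup>2) \<le> (norm f)\<^sup>2"
  unfolding norm_ell2_sq by (rule finite_sum_le_infsum) (use assms coord_summable in auto)

lemma norm_sum_ket_sq:
  assumes "finite S"
  shows "(norm (\<Sum>x\<in>S. ket x))\<^sup>2 = real (card S)"
proof -
  have c: "coord (\<Sum>x\<in>S. ket x) y = (if y \<in> S then 1 else 0)" for y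
    using assms by (simp add: coord_sum ket.rep_eq)
  have "(norm (\<Sum>x\<in>S. ket x))\<^sup>2 = (\<Sum>\<^sub>\<infinity>y\<in>S. (1::real))"
    unfolding norm_ell2_sq c by (rule infsum_cong_neutral) auto
  then show ?thesis using assms by simp
qed

lemma ell2_truncations_tendsto:
  fixes a :: "nat ell2"
  shows "(\<lambda>N. \<Sum>k<N. scaleC (coord a k) (ket k)) \<longlonglongrightarrow> a"
proof -
  let ?s = "\<lambda>N. \<Sum>k<N. scaleC (coord a k) (ket k)"
  let ?q = "\<lambda>k. (cmod (coord a k))\<^sup>2"
  have sums: "?q sums (norm a)\<^sup>2"
    unfolding norm_ell2_sq using has_sum_infsum[OF coord_summable[of a]]
    by (rule has_sum_imp_sums)
  have "(norm (?s N - a))\<^sup>2 = (norm a)\<^sup>2 - (\<Sum>k<N. ?q k)" for N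
  proof -
    have "coord (?s N - a) k = (if k < N then 0 else - coord a k)" for k
      by (simp add: minus_ell2.rep_eq coord_sum coord_scaleC_ket)
    then have "(norm (?s N - a))\<^sup>2 = (\<Sum>\<^sub>\<infinity>k\<in>UNIV - {..<N}. ?q k)"
      unfolding norm_ell2_sq by (intro infsum_cong_neutral) auto
    also have "\<dots> = (norm a)\<^sup>2 - (\<Sum>k<N. ?q k)"
      unfolding norm_ell2_sq by (subst infsum_Diff) (auto simp: coord_summable)
    finally show ?thesis .
  qed
  moreover have "(\<lambda>N. (norm a)\<^sup>2 - (\<Sum>k<N. ?q k)) \<longlonglongrightarrow> (norm a)\<^sup>2 - (norm a)\<^sup>2"
    using sums unfolding sums_def by (intro tendsto_intros)
  ultimately have "(\<lambda>N. (norm (?s N - a))\<^sup>2) \<longlonglongrightarrow> 0" by simp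
  then have "(\<lambda>N. sqrt ((norm (?s N - a))\<^sup>2)) \<longlonglongrightarrow> sqrt 0" by (rule tendsto_real_sqrt)
  then show ?thesis by (simp add: tendsto_norm_zero_iff LIM_zero_iff)
qed

section \<open>Transport along injections and tensor products\<close>

text \<open>Left and right multiplication by a word are both transports of coordinates along an injection
  of the set of words, so facts about them reduce to facts about composing injections.  The value
  for a non-injective map is set to zero, because summing over infinite fibres need not be
  square-summable.\<close>

lift_definition push :: "('a \<Rightarrow> 'b) \<Rightarrow> 'a ell2 \<Rightarrow> 'b ell2"
  is "\<lambda>g f w. if inj g \<and> w \<in> range g then f (inv g w) else 0"
proof -
  fix g :: "'a \<Rightarrow> 'b" and f :: "'a \<Rightarrow> complex"
  assume f: "(\<lambda>x. (cmod (f x))\<^sup>2) summable_on UNIV"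
  let ?h = "\<lambda>w. (cmod (if inj g \<and> w \<in> range g then f (inv g w) else 0))\<^sup>2"
  show "?h summable_on UNIV"
  proof (cases "inj g")
    case True
    have "?h summable_on UNIV \<longleftrightarrow> ?h summable_on range g"
      by (rule summable_on_cong_neutral) auto
    also have "\<dots> \<longleftrightarrow> (?h \<circ> g) summable_on UNIV"
      by (rule summable_on_reindex[OF True])
    also have "?h \<circ> g = (\<lambda>x. (cmod (f x))\<^sup>2)"
      using True by auto
    finally show ?thesis using f by simp
  qed simp
qed

lemma coord_push: "inj g \<Longrightarrow> coord (push g f) (g u) = coord f u"
  by (simp add: push.rep_eq)

lemma coord_push_outside: "w \<notin> range g \<Longrightarrow> coord (push g f) w = 0"
  by (simp add: push.rep_eq)

lemma push_eqI:
  assumes "inj g" "\<And>u. coord h (g u) = coord f u" "\<And>w. w \<notin> range g \<Longrightarrow> coord h w = 0"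
  shows "push g f = h"
proof (rule ell2_eqI)
  fix w show "coord (push g f) w = coord h w"
    using assms by (cases "w \<in> range g") (auto simp: coord_push coord_push_outside)
qed

lemma push_push:
  assumes g: "inj g" and h: "inj h"
  shows "push g (push h f) = push (g \<circ> h) f"
proof (rule push_eqI[symmetric])
  show "inj (g \<circ> h)" using g h by (rule inj_compose)
  show "coord (push g (push h f)) ((g \<circ> h) u) = coord f u" for u
    using g h by (simp add: coord_push)
  show "coord (push g (push h f)) w = 0" if "w \<notin> range (g \<circ> h)" for w
  proof (cases "w \<in> range g")
    case True
    then obtain u where u: "w = g u" by auto
    with that have "u \<notin> range h" by auto
    then show ?thesis using g by (simp add: u coord_push coord_push_outside)
  qed (simp add: coord_push_outside)
qed

lemma push_ket: "inj g \<Longrightarrow> push g (ket u) = ket (g u)"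
  by (rule push_eqI) (auto simp: ket.rep_eq inj_eq)

lemma push_add: "push g (f + f') = push g f + push g f'"
  by transfer auto

lemma push_scaleC: "push g (scaleC c f) = scaleC c (push g f)"
  by transfer auto

lemma push_scaleR: "push g (r *\<^sub>R f) = r *\<^sub>R push g f"
  by transfer auto

lemma norm_push:
  assumes "inj g" shows "norm (push g f) = norm f"
proof -
  have "(norm (push g f))\<^sup>2 = (\<Sum>\<^sub>\<infinity>w\<in>range g. (cmod (coord (push g f) w))\<^sup>2)"
    unfolding norm_ell2_sq by (rule infsum_cong_neutral) (auto simp: coord_push_outside)
  also have "\<dots> = (norm f)\<^sup>2"
    unfolding norm_ell2_sq using assms by (simp add: infsum_reindex o_def coord_push)
  finally show ?thesis by simp
qed

lift_definition tensor :: "'a ell2 \<Rightarrow> 'b ell2 \<Rightarrow> ('a \<times> 'b) ell2"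
  is "\<lambda>f g (x, y). f x * g y"
proof -
  fix f :: "'a \<Rightarrow> complex" and g :: "'b \<Rightarrow> complex"
  assume f: "(\<lambda>x. (cmod (f x))\<^sup>2) summable_on UNIV" and g: "(\<lambda>x. (cmod (g x))\<^sup>2) summable_on UNIV"
  have "(\<lambda>(x, y). (cmod (f x))\<^sup>2 * (cmod (g y))\<^sup>2) summable_on UNIV \<times> UNIV"
    by (rule summable_on_SigmaI[where g = "\<lambda>x. (cmod (f x))\<^sup>2 * (\<Sum>\<^sub>\<infinity>y. (cmod (g y))\<^sup>2)"])
      (auto intro!: has_sum_cmult_right has_sum_infsum summable_on_cmult_left f g)
  then show "(\<lambda>p. (cmod (case p of (x, y) \<Rightarrow> f x * g y))\<^sup>2) summable_on UNIV"
    by (simp add: case_prod_unfold norm_mult power_mult_distrib)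
qed

lemma norm_tensor: "norm (tensor f g) = norm f * norm g"
proof -
  have "(norm (tensor f g))\<^sup>2
      = (\<Sum>\<^sub>\<infinity>(x, y)\<in>UNIV \<times> UNIV. (cmod (coord f x))\<^sup>2 * (cmod (coord g y))\<^sup>2)"
    unfolding norm_ell2_sq tensor.rep_eq
    by (simp add: case_prod_unfold norm_mult power_mult_distrib)
  also have "\<dots> = (\<Sum>\<^sub>\<infinity>x. \<Sum>\<^sub>\<infinity>y. (cmod (coord f x))\<^sup>2 * (cmod (coord g y))\<^sup>2)"
    using coord_summable[of "tensor f g"]
    by (intro infsum_Sigma'_banach[symmetric])
      (simp add: tensor.rep_eq case_prod_unfold norm_mult power_mult_distrib)
  also have "\<dots> = (norm f * norm g)\<^sup>2"
    by (simp add: norm_ell2_sq power_mult_distrib infsum_cmult_right' infsum_cmult_left')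
  finally show ?thesis by simp
qed

lemma tensor_ket: "tensor (ket k) f = push (Pair k) f"
  by (rule push_eqI[symmetric]) (auto simp: tensor.rep_eq ket.rep_eq inj_on_def)

section \<open>The analytic Toeplitz algebra commutes with right multiplication\<close>

lemma L_eq_push: "blinfun_apply (L a) f = push (Cons a) f"
proof -
  have "prepend a f = push (Cons a) f"
  proof (rule push_eqI[symmetric])
    show "coord (prepend a f) w = 0" if "w \<notin> range (Cons a)" for w
      using that by (auto simp: prepend.rep_eq prepend_coords_def split: list.splits)
  qed (auto simp: prepend.rep_eq prepend_coords_def inj_on_def)
  then show ?thesis by (simp add: L.rep_eq)
qed

lemma nc_toeplitz_algebra_L: "L a \<in> nc_toeplitz_algebra"
  unfolding nc_toeplitz_algebra_def wot_closed_algebra_generated_by_def by blast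

lemma nc_toeplitz_algebra_comp:
  "A \<in> nc_toeplitz_algebra \<Longrightarrow> B \<in> nc_toeplitz_algebra \<Longrightarrow> A o\<^sub>L B \<in> nc_toeplitz_algebra"
  unfolding nc_toeplitz_algebra_def wot_closed_algebra_generated_by_def unital_subalgebra_def
  by blast

lemma nc_toeplitz_algebra_add:
  "A \<in> nc_toeplitz_algebra \<Longrightarrow> B \<in> nc_toeplitz_algebra \<Longrightarrow> A + B \<in> nc_toeplitz_algebra"
  unfolding nc_toeplitz_algebra_def wot_closed_algebra_generated_by_def unital_subalgebra_def
  by blast

lemma nc_toeplitz_algebra_scaleC:
  "A \<in> nc_toeplitz_algebra \<Longrightarrow> scaleC_op c o\<^sub>L A \<in> nc_toeplitz_algebra"
  unfolding nc_toeplitz_algebra_def wot_closed_algebra_generated_by_def unital_subalgebra_def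
  by blast

lemma nc_toeplitz_algebra_id: "id_blinfun \<in> nc_toeplitz_algebra"
  unfolding nc_toeplitz_algebra_def wot_closed_algebra_generated_by_def unital_subalgebra_def
  by blast

text \<open>The operators that commute with one fixed transport.  Taking transport along right
  multiplication by a word gives an upper bound for the algebra generated by the left
  creation operators.\<close>

definition push_commutant :: "('a \<Rightarrow> 'a) \<Rightarrow> 'a op set"
  where "push_commutant g = {A \<in> bounded_ops. \<forall>f. A (push g f) = push g (A f)}"

text \<open>Tested against basis vectors, the commutation relation only compares matrix coefficients
  of the operator: the coordinate of a transported vector at \<open>w\<close> is either zero or the
  coordinate of the original vector at the preimage of \<open>w\<close>.  Hence the relation is a closed
  condition on the family of matrix coefficients.\<close>

lemma closedin_push_commutant: "closedin weak_operator_topology (push_commutant g)"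
proof -
  let ?\<Phi> = "\<lambda>T :: 'a op. \<lambda>(f, h). cinner (T f) h"
  define K :: "('a ell2 \<times> 'a ell2 \<Rightarrow> complex) set"
    where "K = {\<phi>. \<forall>f w. \<phi> (push g f, ket w)
      = (if inj g \<and> w \<in> range g then 1 else 0) * \<phi> (f, ket (inv g w))}"
  have "closed K"
    unfolding K_def
    by (intro closed_Collect_all closed_Collect_eq continuous_intros
        continuous_on_product_coordinates)
  moreover have "push_commutant g = ?\<Phi> -` K \<inter> bounded_ops"
  proof -
    have "(A (push g f) = push g (A f)) \<longleftrightarrow> (\<forall>w. cinner (A (push g f)) (ket w)
      = (if inj g \<and> w \<in> range g then 1 else 0) * cinner (A f) (ket (inv g w)))"
      for A :: "'a op" and f
      unfolding coord_inject[symmetric] fun_eq_iff cinner_ket by (auto simp: push.rep_eq)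
    then show ?thesis by (auto simp: push_commutant_def K_def)
  qed
  ultimately show ?thesis
    unfolding closedin_def weak_operator_topology_def topspace_pullback_topology
      openin_pullback_topology
    by (auto intro!: exI[of _ "- K"])
qed

lemma unital_subalgebra_push_commutant: "unital_subalgebra (push_commutant g)"
  unfolding unital_subalgebra_def push_commutant_def bounded_ops_def
  by (auto simp: blinfun.add_left push_add push_scaleC scaleC_op.rep_eq scaleC.rep_eq
      plus_ell2.rep_eq algebra_simps intro!: ell2_eqI)

text \<open>For the generators this is associativity of concatenation: prepending a letter and appending
  a word can be done in either order.\<close>

lemma nc_toeplitz_commutes_right_append:
  assumes A: "A \<in> nc_toeplitz_algebra"
  shows "A (push (\<lambda>u. u @ v) f) = push (\<lambda>u. u @ v) (A f)"
proof -
  have "L a \<in> push_commutant (\<lambda>u. u @ v)" for a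
    by (simp add: push_commutant_def L_bounded_ops L_eq_push push_push inj_on_def o_def)
  then have "A \<in> push_commutant (\<lambda>u. u @ v)"
    using A unital_subalgebra_push_commutant closedin_push_commutant
    unfolding nc_toeplitz_algebra_def wot_closed_algebra_generated_by_def by blast
  then show ?thesis by (simp add: push_commutant_def)
qed

section \<open>Norm-convergent series in the left ideal\<close>

text \<open>The first letter of the word that differs from \<open>x\<close> is the displayed \<open>y\<close>, so its position
  determines \<open>k\<close>.  This is the orthogonality of the ranges of the \<open>L\<^sub>x\<^sup>k L\<^sub>y\<close>.\<close>

lemma inj_replicate_Cons:
  assumes "x \<noteq> y"
  shows "inj (\<lambda>(k, v). replicate k x @ y # v)"
proof (rule injI, clarify)
  fix k l :: nat and v w
  assume "replicate k x @ y # v = replicate l x @ y # w"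
  then show "k = l \<and> v = w"
  proof (induction k arbitrary: l)
    case 0 then show ?case using assms by (cases l) auto
  next
    case (Suc k) then show ?case using assms by (cases l) auto
  qed
qed

text \<open>The sum \<open>\<Sum>\<^sub>k a\<^sub>k L\<^sub>x\<^sup>k L\<^sub>y f\<close>.  Because the ranges are orthogonal it is a copy of the tensor
  product of \<open>a\<close> and \<open>f\<close>; defining it this way gives a bounded operator with norm bound
  \<open>\<parallel>a\<parallel>\<close> without discussing convergence.\<close>

definition series_product :: "'a \<Rightarrow> 'a \<Rightarrow> nat ell2 \<Rightarrow> 'a list ell2 \<Rightarrow> 'a list ell2"
  where "series_product x y a f = push (\<lambda>(k, v). replicate k x @ y # v) (tensor a f)"

lemma bounded_bilinear_series_product:
  assumes "x \<noteq> y"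
  shows "bounded_bilinear (series_product x y)"
proof
  fix a a' :: "nat ell2" and f f' :: "'a list ell2" and r :: real
  have "tensor (a + a') f = tensor a f + tensor a' f"
    by transfer (auto simp: algebra_simps)
  then show "series_product x y (a + a') f = series_product x y a f + series_product x y a' f"
    by (simp add: series_product_def push_add)
  have "tensor a (f + f') = tensor a f + tensor a f'"
    by transfer (auto simp: algebra_simps)
  then show "series_product x y a (f + f') = series_product x y a f + series_product x y a f'"
    by (simp add: series_product_def push_add)
  have "tensor (r *\<^sub>R a) f = r *\<^sub>R tensor a f" by transfer auto
  then show "series_product x y (r *\<^sub>R a) f = r *\<^sub>R series_product x y a f"
    by (simp add: series_product_def push_scaleR)
  have "tensor a (r *\<^sub>R f) = r *\<^sub>R tensor a f" by transfer auto
  then show "series_product x y a (r *\<^sub>R f) = r *\<^sub>R series_product x y a f"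
    by (simp add: series_product_def push_scaleR)
  show "\<exists>K. \<forall>a f. norm (series_product x y a f) \<le> norm a * norm f * K"
    by (rule exI[of _ 1])
      (simp add: series_product_def norm_push inj_replicate_Cons[OF assms] norm_tensor)
qed

definition series_op :: "'a \<Rightarrow> 'a \<Rightarrow> nat ell2 \<Rightarrow> 'a list op"
  where "series_op x y = bounded_bilinear.prod_right (series_product x y)"

lemma series_op_apply:
  "x \<noteq> y \<Longrightarrow> series_op x y a f = series_product x y a f"
  unfolding series_op_def
  by (simp add: bounded_bilinear.prod_right.rep_eq bounded_bilinear_series_product)

lemma bounded_linear_series_op:
  "x \<noteq> y \<Longrightarrow> bounded_linear (series_op x y)"
  unfolding series_op_def
  by (rule bounded_bilinear.bounded_linear_prod_right[OF bounded_bilinear_series_product])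

lemma series_op_scaleC:
  assumes "x \<noteq> y"
  shows "series_op x y (scaleC c a) = scaleC_op c o\<^sub>L series_op x y a"
proof -
  have "tensor (scaleC c a) f = scaleC c (tensor a f)" for f :: "'a list ell2"
    by transfer auto
  then show ?thesis
    by (intro blinfun_eqI)
      (simp add: series_op_apply assms series_product_def push_scaleC scaleC_op.rep_eq)
qed

lemma series_op_ket_0:
  assumes "x \<noteq> y"
  shows "series_op x y (ket 0) = L y"
  by (rule blinfun_eqI)
    (simp add: series_op_apply assms series_product_def tensor_ket
      push_push[OF inj_replicate_Cons[OF assms]] inj_on_def o_def L_eq_push)

lemma series_op_ket_Suc:
  assumes "x \<noteq> y"
  shows "series_op x y (ket (Suc k)) = L x o\<^sub>L series_op x y (ket k)"
  by (rule blinfun_eqI)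
    (simp add: series_op_apply assms series_product_def tensor_ket
      push_push[OF inj_replicate_Cons[OF assms]] push_push[of "Cons x"]
      inj_on_def o_def L_eq_push)

text \<open>Finitely supported coefficients give polynomials in \<open>L\<^sub>x\<close> times \<open>L\<^sub>y\<close>.  They are dense in the
  square-summable ones, and the operator depends continuously on the coefficients.\<close>

lemma series_op_in_left_ideal:
  assumes xy: "x \<noteq> y" and closed: "closed {A o\<^sub>L L y | A. A \<in> nc_toeplitz_algebra}"
  shows "series_op x y a \<in> {A o\<^sub>L L y | A. A \<in> nc_toeplitz_algebra}" (is "_ \<in> ?J")
proof (rule closed_sequentially[OF closed])
  interpret series_op: bounded_linear "series_op x y"
    using xy by (rule bounded_linear_series_op)
  show "(\<lambda>N. series_op x y (\<Sum>k<N. scaleC (coord a k) (ket k))) \<longlonglongrightarrow> series_op x y a"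
    by (intro series_op.tendsto ell2_truncations_tendsto)
  have assoc: "(S o\<^sub>L T) o\<^sub>L U = S o\<^sub>L (T o\<^sub>L U)" for S T U :: "'a list op"
    by (rule blinfun_eqI) simp
  have add: "S + T \<in> ?J" if ST: "S \<in> ?J" "T \<in> ?J" for S T
  proof -
    obtain A B where "S = A o\<^sub>L L y" "T = B o\<^sub>L L y"
      and AB: "A \<in> nc_toeplitz_algebra" "B \<in> nc_toeplitz_algebra"
      using ST by auto
    then have "S + T = (A + B) o\<^sub>L L y"
      by (simp add: bounded_bilinear.add_left[OF bounded_bilinear_blinfun_compose])
    then show ?thesis using nc_toeplitz_algebra_add[OF AB] by blast
  qed
  have left_mult: "S o\<^sub>L T \<in> ?J"
    if S: "\<And>A. A \<in> nc_toeplitz_algebra \<Longrightarrow> S o\<^sub>L A \<in> nc_toeplitz_algebra" and T: "T \<in> ?J" for S T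
  proof -
    obtain A where A: "A \<in> nc_toeplitz_algebra" "T = A o\<^sub>L L y" using T by auto
    then have "S o\<^sub>L T = (S o\<^sub>L A) o\<^sub>L L y" by (simp add: assoc)
    then show ?thesis using S[OF A(1)] by blast
  qed
  have scale: "scaleC_op c o\<^sub>L S \<in> ?J" if "S \<in> ?J" for c S
    using nc_toeplitz_algebra_scaleC that by (rule left_mult)
  have monomial: "series_op x y (ket k) \<in> ?J" for k
  proof (induction k)
    case 0
    have "L y = id_blinfun o\<^sub>L L y" by (rule blinfun_eqI) simp
    then show ?case using nc_toeplitz_algebra_id by (auto simp: series_op_ket_0[OF xy])
  next
    case (Suc k)
    then show ?case
      unfolding series_op_ket_Suc[OF xy]
      by (intro left_mult nc_toeplitz_algebra_comp[OF nc_toeplitz_algebra_L])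
  qed
  have "scaleC 0 (ket 0) = (0 :: nat ell2)" by transfer simp
  then have zero: "series_op x y 0 \<in> ?J"
    using scale[OF monomial, of 0 0] by (simp add: series_op_scaleC[OF xy, symmetric])
  show "series_op x y (\<Sum>k<N. scaleC (coord a k) (ket k)) \<in> ?J" for N
  proof (induction N)
    case 0
    then show ?case using zero by simp
  next
    case (Suc N)
    then show ?case
      by (simp add: series_op.add series_op_scaleC[OF xy] add scale monomial del: mem_Collect_eq)
  qed
qed

section \<open>The left ideal is not closed\<close>

lemma coord_series_op:
  assumes "x \<noteq> y"
  shows "coord (series_op x y a f) (replicate k x @ y # v) = coord a k * coord f v"
  using coord_push[OF inj_replicate_Cons[OF assms], of "tensor a f" "(k, v)"]
  by (simp add: series_op_apply[OF assms] series_product_def tensor.rep_eq)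

text \<open>A left factor \<open>A\<close> is the Toeplitz operator with symbol \<open>\<Sum>\<^sub>k a\<^sub>k t\<^sup>k\<close> on the span of the powers of
  \<open>x\<close>.  Right multiplication carries \<open>A \<xi>\<^sub>1\<close> both to \<open>A \<xi>\<^sub>y\<close>, which the factorization
  prescribes, and to the columns of \<open>A\<close> at the powers of \<open>x\<close>.\<close>

lemma coord_left_factor:
  assumes xy: "x \<noteq> y" and A: "A \<in> nc_toeplitz_algebra" and factor: "series_op x y a = A o\<^sub>L L y"
  shows "coord (A (ket (replicate j x))) (replicate i x) = (if j \<le> i then coord a (i - j) else 0)"
proof -
  have shift: "A (ket v) = push (\<lambda>u. u @ v) (A (ket []))" for v
    using nc_toeplitz_commutes_right_append[OF A, of v "ket []"] by (simp add: push_ket inj_on_def)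
  have inj: "inj (\<lambda>u. u @ v)" for v :: "'a list" by (simp add: inj_on_def)
  have "coord a k = coord (A (ket [y])) (replicate k x @ [y])" for k
    using coord_series_op[OF xy, of a "ket []" k "[]"] by (simp add: factor L_ket ket.rep_eq)
  then have symbol: "coord (A (ket [])) (replicate k x) = coord a k" for k
    unfolding shift[of "[y]"] using coord_push[OF inj] by metis
  show ?thesis
  proof (cases "j \<le> i")
    case True
    then have "replicate i x = replicate (i - j) x @ replicate j x"
      by (simp add: replicate_add[symmetric])
    then show ?thesis using True symbol coord_push[OF inj] shift by metis
  next
    case False
    then have "replicate i x \<notin> range (\<lambda>u. u @ replicate j x)"
      by (metis (no_types, lifting) imageE le_add2 length_append length_replicate)
    then show ?thesis using False by (subst shift) (simp add: coord_push_outside)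
  qed
qed

lift_definition harmonic :: "nat ell2" is "\<lambda>k. complex_of_real (inverse (real (Suc k)))"
proof -
  have "summable (\<lambda>k. 1 / (real (Suc k))\<^sup>2)"
    using inverse_squares_sums by (simp add: sums_iff)
  then show "(\<lambda>k. (cmod (complex_of_real (inverse (real (Suc k)))))\<^sup>2) summable_on UNIV"
    by (subst summable_on_UNIV_nonneg_real_iff)
      (simp_all add: norm_inverse power_inverse inverse_eq_divide norm_divide power_divide
        del: of_nat_Suc)
qed

text \<open>The Toeplitz matrix with entries \<open>1 / (i - j + 1)\<close> for \<open>j \<le> i\<close> is unbounded: applied to the
  vector of \<open>2 N\<close> ones, row \<open>i\<close> yields a harmonic number, which exceeds \<open>harm N\<close> in the second half
  of the rows, while the squared norm of the vector is only \<open>2 N\<close>.\<close>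

lemma harmonic_not_left_factor:
  assumes xy: "x \<noteq> y" and A: "A \<in> nc_toeplitz_algebra"
  shows "series_op x y harmonic \<noteq> A o\<^sub>L L y"
proof
  assume factor: "series_op x y harmonic = A o\<^sub>L L y"
  have bound: "(harm N)\<^sup>2 \<le> 2 * (norm A)\<^sup>2" if N: "N > 0" for N
  proof -
    define f :: "'a list ell2" where "f = (\<Sum>j<2 * N. ket (replicate j x))"
    have inj: "inj_on (\<lambda>j. replicate j x) J" for J
      by (rule inj_onI) (metis length_replicate)
    have "f = (\<Sum>w\<in>(\<lambda>j. replicate j x) ` {..<2 * N}. ket w)"
      by (simp add: f_def sum.reindex[OF inj])
    then have norm_f: "(norm f)\<^sup>2 = 2 * real N"
      by (simp add: norm_sum_ket_sq card_image[OF inj])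
    have coord_Af: "harm N \<le> cmod (coord (A f) (replicate i x))" if i: "i \<in> {N..<2 * N}" for i
    proof -
      have "coord (A f) (replicate i x)
          = (\<Sum>j<2 * N. if j \<le> i then coord harmonic (i - j) else 0)"
        by (simp add: f_def blinfun.sum_right coord_sum coord_left_factor[OF xy A factor])
      also have "\<dots> = (\<Sum>j\<in>{..i}. coord harmonic (i - j))"
        using i by (intro sum.mono_neutral_cong_right) auto
      also have "\<dots> = (\<Sum>k\<in>{..i}. coord harmonic k)"
        by (rule sum.reindex_bij_witness[of _ "\<lambda>k. i - k" "\<lambda>k. i - k"]) auto
      also have "\<dots> = complex_of_real (harm (Suc i))"
        unfolding harm_altdef harmonic.rep_eq lessThan_Suc_atMost by simp
      finally have "cmod (coord (A f) (replicate i x)) = harm (Suc i)"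
        by (simp add: harm_nonneg)
      also have "\<dots> \<ge> harm N" using i by (intro harm_mono) auto
      finally show ?thesis .
    qed
    have "real N * (harm N)\<^sup>2 = (\<Sum>i\<in>{N..<2 * N}. (harm N)\<^sup>2)" by simp
    also have "\<dots> \<le> (\<Sum>i\<in>{N..<2 * N}. (cmod (coord (A f) (replicate i x)))\<^sup>2)"
      by (intro sum_mono power_mono coord_Af harm_nonneg)
    also have "\<dots> = (\<Sum>w\<in>(\<lambda>i. replicate i x) ` {N..<2 * N}. (cmod (coord (A f) w))\<^sup>2)"
      by (simp add: sum.reindex[OF inj])
    also have "\<dots> \<le> (norm (A f))\<^sup>2" by (rule sum_coord_sq_le_norm_sq) simp
    also have "\<dots> \<le> (norm A * norm f)\<^sup>2" by (intro power_mono norm_blinfun) simp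
    also have "\<dots> = real N * (2 * (norm A)\<^sup>2)" by (simp add: power_mult_distrib norm_f)
    finally show ?thesis using N by simp
  qed
  have "\<forall>\<^sub>F N in sequentially. N > 0 \<and> harm N \<ge> 2 * norm A + 1"
    using harm_at_top by (intro eventually_conj eventually_gt_at_top) (simp add: filterlim_at_top)
  then obtain N where N: "N > 0" "harm N \<ge> 2 * norm A + 1"
    using eventually_happens'[OF sequentially_bot] by blast
  then have "(2 * norm A + 1)\<^sup>2 \<le> 2 * (norm A)\<^sup>2"
    using bound[OF N(1)] power_mono[OF N(2), of 2] by simp
  moreover have "2 * (norm A)\<^sup>2 < (2 * norm A + 1)\<^sup>2"
    by (simp add: power2_sum power_mult_distrib add_pos_nonneg add_nonneg_pos)
  ultimately show False by simp
qed

theorem corollary3p5: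
  fixes n :: nat and z :: "nat \<Rightarrow> 'a"
  assumes "n \<ge> 2"
    and "bij_betw z {1..n} (UNIV :: 'a set)"
  shows "\<not> closed {A o\<^sub>L L (z 2) | A. A \<in> nc_toeplitz_algebra}"
proof
  assume closed: "closed {A o\<^sub>L L (z 2) | A. A \<in> nc_toeplitz_algebra}"
  have distinct: "z 1 \<noteq> z 2"
    using assms inj_onD[of z "{1..n}" 1 2] by (auto simp: bij_betw_def)
  obtain A where A: "A \<in> nc_toeplitz_algebra" "series_op (z 1) (z 2) harmonic = A o\<^sub>L L (z 2)"
    using series_op_in_left_ideal[OF distinct closed, of harmonic] by auto
  show False
    using harmonic_not_left_factor[OF distinct A(1)] A(2) by contradiction
qed

end
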